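(* The internal tangent space to a point is a diffeological invariant. That is, if $X$ and $Y$ are diffeological spaces and $\chi:X\to Y$ is a (diffeological) diffeomorphism mapping a point $x\in X$ to $y=\chi(x)\in Y$, then $T_x(X)\cong T_y(Y)$ as real vector spaces.
   Context: Diffeological spaces. A parametrization of a set $X$ is a map $p:U\to X$ with $U\subseteq\mathbb{R}^n$ open, $n\ge 0$. A diffeological space is a nonempty set $X$ with a collection $\mathcal{D}_X$ of parametrizations, called plots, such that: (1) all constant parametrizations $\mathbb{R}^n\to X$ are plots; (2) if $p:U\to X$ is a plot, $V\subseteq\mathbb{R}^m$ is open and $F:V\to U$ is smooth, then $p\circ F$ is a plot; (3) a parametrization $p:U\to X$ such that every $u\in U$ has an open neighborhood $V\subseteq U$ with $p|_V$ a plot is itself a plot. A map $f:X\to Y$ of diffeological spaces is smooth if $f\circ p$ is a plot of $Y$ for every plot $p$ of $X$; it is a diffeomorphism if it is smooth with a smooth inverse. Internal tangent space. A plot pointing to $x\in X$, written $p:(U_p,0)\to(X,x)$, is a plot with connected domain $U_p$ containing $0$ and $p(0)=x$. The internal tangent space is the real vector space $T_x(X)=F/R$, where $F=\bigoplus_p T_0(U_p)$ is indexed by all plots pointing to $x$ (with $(p,v)$ denoting $v\in T_0(U_p)$ in the summand indexed by $p$), and $R$ is the span of all vectors $(p,v)-(q,g_*(v))$, where $p,q$ are plots pointing to $x$, $v\in T_0(U_p)$, and $g:(U_p,0)\to(U_q,0)$ is a germ at $0$ of smooth maps with $p=q\circ g$ as germs at $0$. *)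

theory Defs
  imports
    "HOL-Analysis.Analysis"
    "HOL-Algebra.AbelCoset"
    "Jordan_Normal_Form.Missing_VectorSpace"
begin

section \<open>Smooth maps between open subsets of Euclidean spaces\<close>

text \<open>
  Dimensions have to vary inside the definition of a diffeology, so \<open>\<real>\<^sup>n\<close> is the library space
  \<^term>\<open>Euclidean_space n\<close>: the functions \<^typ>\<open>nat \<Rightarrow> real\<close> vanishing at all indices \<open>i \<ge> n\<close>,
  with the product topology. Its origin is \<^term>\<open>\<lambda>_::nat. 0::real\<close>.
\<close>

definition partial_deriv :: "nat \<Rightarrow> ((nat \<Rightarrow> real) \<Rightarrow> real) \<Rightarrow> (nat \<Rightarrow> real) \<Rightarrow> real" where
  "partial_deriv i f x = deriv (\<lambda>t. f (x(i := t))) (x i)"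

text \<open>
  \<open>C_k_on n U k f\<close>: on the open set \<open>U \<subseteq> \<real>\<^sup>n\<close>, all iterated partial derivatives of \<open>f\<close> of order
  at most \<open>k\<close> exist and are continuous. Only the values of \<open>f\<close> on \<open>U\<close> matter, as \<open>U\<close> is open.
\<close>

primrec C_k_on :: "nat \<Rightarrow> (nat \<Rightarrow> real) set \<Rightarrow> nat \<Rightarrow> ((nat \<Rightarrow> real) \<Rightarrow> real) \<Rightarrow> bool" where
  "C_k_on n U 0 f \<longleftrightarrow>
     continuous_map (subtopology (Euclidean_space n) U) euclideanreal f"
| "C_k_on n U (Suc k) f \<longleftrightarrow>
     continuous_map (subtopology (Euclidean_space n) U) euclideanreal f \<and>
     (\<forall>i<n. (\<forall>x\<in>U. (\<lambda>t. f (x(i := t))) field_differentiable at (x i)) \<and>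
            C_k_on n U k (partial_deriv i f))"

definition smooth_map ::
  "nat \<Rightarrow> (nat \<Rightarrow> real) set \<Rightarrow> nat \<Rightarrow> (nat \<Rightarrow> real) set \<Rightarrow> ((nat \<Rightarrow> real) \<Rightarrow> (nat \<Rightarrow> real)) \<Rightarrow> bool" where
  "smooth_map n U m V F \<longleftrightarrow> F \<in> U \<rightarrow> V \<and> (\<forall>j<m. \<forall>k. C_k_on n U k (\<lambda>x. F x j))"

text \<open>The differential at \<open>a\<close> of a map from \<open>\<real>\<^sup>n\<close> to \<open>\<real>\<^sup>m\<close>: its Jacobian matrix applied to \<open>v\<close>.\<close>

definition differential_at ::
  "nat \<Rightarrow> nat \<Rightarrow> ((nat \<Rightarrow> real) \<Rightarrow> (nat \<Rightarrow> real)) \<Rightarrow> (nat \<Rightarrow> real) \<Rightarrow> (nat \<Rightarrow> real) \<Rightarrow> (nat \<Rightarrow> real)" where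
  "differential_at n m F a v =
     (\<lambda>j. if j < m then \<Sum>i<n. partial_deriv i (\<lambda>x. F x j) a * v i else 0)"


section \<open>Diffeological spaces\<close>

text \<open>
  A parametrization \<open>p : U \<rightarrow> X\<close> with \<open>U\<close> open in \<open>\<real>\<^sup>n\<close> is the triple \<open>(n, U, p)\<close>. The map is
  required to be extensional (\<^term>\<open>undefined\<close> outside \<open>U\<close>), so that equality of triples is
  equality of parametrizations.
\<close>

type_synonym 'a parametrization = "nat \<times> (nat \<Rightarrow> real) set \<times> ((nat \<Rightarrow> real) \<Rightarrow> 'a)"

definition parametrizations :: "'a set \<Rightarrow> 'a parametrization set" where
  "parametrizations X = {(n, U, p). openin (Euclidean_space n) U \<and> p \<in> U \<rightarrow>\<^sub>E X}"

locale diffeological_space =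
  fixes X :: "'a set" and D :: "'a parametrization set"
  assumes nonempty: "X \<noteq> {}"
    and plots_are_parametrizations: "D \<subseteq> parametrizations X"
    and constant_plot: "\<And>n x. x \<in> X \<Longrightarrow>
      (n, topspace (Euclidean_space n), \<lambda>u\<in>topspace (Euclidean_space n). x) \<in> D"
    and plot_compose: "\<And>n U p m V F. \<lbrakk>(n, U, p) \<in> D; openin (Euclidean_space m) V;
      smooth_map m V n U F\<rbrakk> \<Longrightarrow> (m, V, compose V p F) \<in> D"
    and plot_local: "\<And>n U p. \<lbrakk>(n, U, p) \<in> parametrizations X;
      \<And>u. u \<in> U \<Longrightarrow> \<exists>V. openin (Euclidean_space n) V \<and> u \<in> V \<and> V \<subseteq> U \<and>
        (n, V, restrict p V) \<in> D\<rbrakk> \<Longrightarrow> (n, U, p) \<in> D"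

definition diffeological_smooth ::
  "'a set \<Rightarrow> 'a parametrization set \<Rightarrow> 'b set \<Rightarrow> 'b parametrization set \<Rightarrow> ('a \<Rightarrow> 'b) \<Rightarrow> bool" where
  "diffeological_smooth X DX Y DY f \<longleftrightarrow>
     f \<in> X \<rightarrow> Y \<and> (\<forall>(n, U, p)\<in>DX. (n, U, compose U f p) \<in> DY)"

definition diffeological_diffeomorphism ::
  "'a set \<Rightarrow> 'a parametrization set \<Rightarrow> 'b set \<Rightarrow> 'b parametrization set \<Rightarrow> ('a \<Rightarrow> 'b) \<Rightarrow> bool" where
  "diffeological_diffeomorphism X DX Y DY f \<longleftrightarrow>
     diffeological_smooth X DX Y DY f \<and>
     (\<exists>g. diffeological_smooth Y DY X DX g \<and> (\<forall>x\<in>X. g (f x) = x) \<and> (\<forall>y\<in>Y. f (g y) = y))"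


section \<open>Direct sums, quotients and isomorphism of modules\<close>

text \<open>The fields \<^const>\<open>monoid.mult\<close> and \<^const>\<open>one\<close> of a module record are unused dummies.\<close>

definition direct_sum_family ::
  "'i set \<Rightarrow> ('i \<Rightarrow> ('r, 'v) module) \<Rightarrow> ('r, 'i \<Rightarrow> 'v) module" where
  "direct_sum_family I M =
     \<lparr>carrier = {f \<in> (\<Pi>\<^sub>E i\<in>I. carrier (M i)). finite {i \<in> I. f i \<noteq> \<zero>\<^bsub>M i\<^esub>}},
      monoid.mult = (\<lambda>f g. \<lambda>i\<in>I. \<zero>\<^bsub>M i\<^esub>),
      one = (\<lambda>i\<in>I. \<zero>\<^bsub>M i\<^esub>),
      ring.zero = (\<lambda>i\<in>I. \<zero>\<^bsub>M i\<^esub>),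
      add = (\<lambda>f g. \<lambda>i\<in>I. f i \<oplus>\<^bsub>M i\<^esub> g i),
      smult = (\<lambda>c f. \<lambda>i\<in>I. c \<odot>\<^bsub>M i\<^esub> f i)\<rparr>"

definition summand_embedding ::
  "'i set \<Rightarrow> ('i \<Rightarrow> ('r, 'v) module) \<Rightarrow> 'i \<Rightarrow> 'v \<Rightarrow> 'i \<Rightarrow> 'v" where
  "summand_embedding I M i v = (\<lambda>j\<in>I. if j = i then v else \<zero>\<^bsub>M j\<^esub>)"

definition quotient_module :: "('r, 'v) module \<Rightarrow> 'v set \<Rightarrow> ('r, 'v set) module" where
  "quotient_module M N =
     \<lparr>carrier = a_rcosets\<^bsub>M\<^esub> N,
      monoid.mult = (\<lambda>A B. N),
      one = N,
      ring.zero = N,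
      add = (\<lambda>A B. A <+>\<^bsub>M\<^esub> B),
      smult = (\<lambda>c A. \<Union>a\<in>A. N +>\<^bsub>M\<^esub> (c \<odot>\<^bsub>M\<^esub> a))\<rparr>"

text \<open>
  The locale \<^locale>\<open>linear_map\<close> includes the assumption that \<open>V\<close> and \<open>W\<close> are vector spaces
  over \<open>K\<close>.
\<close>

definition vectorspace_isomorphic ::
  "'k ring \<Rightarrow> ('k, 'v) module \<Rightarrow> ('k, 'w) module \<Rightarrow> bool" where
  "vectorspace_isomorphic K V W \<longleftrightarrow>
     (\<exists>h. linear_map K V W h \<and> bij_betw h (carrier V) (carrier W))"

definition real_field :: "real ring" where
  "real_field = \<lparr>carrier = UNIV, monoid.mult = (*), one = 1, ring.zero = 0, add = (+)\<rparr>"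


section \<open>The internal tangent space\<close>

definition pointed_plots :: "'a parametrization set \<Rightarrow> 'a \<Rightarrow> 'a parametrization set" where
  "pointed_plots D x = {(n, U, p) \<in> D.
     connectedin (Euclidean_space n) U \<and> (\<lambda>_. 0) \<in> U \<and> p (\<lambda>_. 0) = x}"

text \<open>\<open>T\<^sub>0(U)\<close> for an open \<open>U \<subseteq> \<real>\<^sup>n\<close> containing \<open>0\<close>, identified with \<open>\<real>\<^sup>n\<close> as usual.\<close>

definition euclidean_tangent_space :: "nat \<Rightarrow> (real, nat \<Rightarrow> real) module" where
  "euclidean_tangent_space n =
     \<lparr>carrier = topspace (Euclidean_space n),
      monoid.mult = (\<lambda>v w i. 0),
      one = (\<lambda>i. 0),
      ring.zero = (\<lambda>i. 0),
      add = (\<lambda>v w i. v i + w i),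
      smult = (\<lambda>c v i. c * v i)\<rparr>"

abbreviation plot_tangent_space :: "'a parametrization \<Rightarrow> (real, nat \<Rightarrow> real) module" where
  "plot_tangent_space \<equiv> \<lambda>(n, U, p). euclidean_tangent_space n"

definition tangent_sum ::
  "'a parametrization set \<Rightarrow> 'a \<Rightarrow> (real, 'a parametrization \<Rightarrow> nat \<Rightarrow> real) module" where
  "tangent_sum D x = direct_sum_family (pointed_plots D x) plot_tangent_space"

definition tangent_vector ::
  "'a parametrization set \<Rightarrow> 'a \<Rightarrow> 'a parametrization \<Rightarrow> (nat \<Rightarrow> real) \<Rightarrow>
   'a parametrization \<Rightarrow> nat \<Rightarrow> real" where
  "tangent_vector D x = summand_embedding (pointed_plots D x) plot_tangent_space"

text \<open>
  A germ at \<open>0\<close> is given by a representative \<open>g\<close> on an open neighbourhood \<open>V\<close> of \<open>0\<close>. Here \<open>V\<close> is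
  taken so small that the equality of germs \<open>p = q \<circ> g\<close> already holds pointwise on \<open>V\<close>.
\<close>

definition tangent_relations ::
  "'a parametrization set \<Rightarrow> 'a \<Rightarrow> ('a parametrization \<Rightarrow> nat \<Rightarrow> real) set" where
  "tangent_relations D x =
     {tangent_vector D x (n, U, p) v \<ominus>\<^bsub>tangent_sum D x\<^esub>
        tangent_vector D x (m, W, q) (differential_at n m g (\<lambda>_. 0) v) |
      n U p m W q v V g.
        (n, U, p) \<in> pointed_plots D x \<and> (m, W, q) \<in> pointed_plots D x \<and>
        v \<in> carrier (euclidean_tangent_space n) \<and>
        openin (Euclidean_space n) V \<and> (\<lambda>_. 0) \<in> V \<and> V \<subseteq> U \<and>
        smooth_map n V m W g \<and> g (\<lambda>_. 0) = (\<lambda>_. 0) \<and>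
        (\<forall>u\<in>V. p u = q (g u))}"

definition internal_tangent_space ::
  "'a parametrization set \<Rightarrow> 'a \<Rightarrow> (real, ('a parametrization \<Rightarrow> nat \<Rightarrow> real) set) module" where
  "internal_tangent_space D x =
     quotient_module (tangent_sum D x)
       (LinearCombinations.module.span real_field (tangent_sum D x) (tangent_relations D x))"

end

theory Submission
  imports Defs
begin

text \<open>
  Composition with \<open>\<chi>\<close> is a bijection between the plots pointing to \<open>x\<close> and those pointing to
  \<open>\<chi> x\<close> that leaves the domains unchanged. It therefore identifies the two direct sums \<open>F\<close> by a
  mere change of index set. Since \<open>p = q \<circ> g\<close> implies \<open>\<chi> \<circ> p = (\<chi> \<circ> q) \<circ> g\<close>, this identification
  maps relations to relations, with the same germ \<open>g\<close> and the same vector; the same holds for the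
  inverse of \<open>\<chi>\<close>. Hence it maps one span \<open>R\<close> onto the other and descends to the quotients.
\<close>

section \<open>Direct sums of families of modules\<close>

text \<open>The equational axioms hold coordinatewise. Closure also needs finite support: the
  support of a sum lies in the union of the two supports, and negation and scaling do not enlarge a
  support.\<close>

lemma module_direct_sum_family:
  assumes R: "cring R" and M: "\<And>i. i \<in> I \<Longrightarrow> module R (M i)"
  shows "module R (direct_sum_family I M)"
proof -
  note groups = module.axioms(2)[OF M]
  note monoids = abelian_group.axioms(1)[OF groups]
  show ?thesis
  proof (rule module_criteria[OF R], goal_cases)
    case 1
    show ?case
      by (auto simp: direct_sum_family_def abelian_monoid.zero_closed[OF monoids])
  next
    case 2
    show ?case
    proof (intro allI impI)
      fix v w
      assume vw: "v \<in> carrier (direct_sum_family I M) \<and> w \<in> carrier (direct_sum_family I M)"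
      have "{i \<in> I. v i \<oplus>\<^bsub>M i\<^esub> w i \<noteq> \<zero>\<^bsub>M i\<^esub>}
              \<subseteq> {i \<in> I. v i \<noteq> \<zero>\<^bsub>M i\<^esub>} \<union> {i \<in> I. w i \<noteq> \<zero>\<^bsub>M i\<^esub>}"
        by (auto simp: abelian_monoid.l_zero[OF monoids] abelian_monoid.zero_closed[OF monoids])
      with vw have "finite {i \<in> I. v i \<oplus>\<^bsub>M i\<^esub> w i \<noteq> \<zero>\<^bsub>M i\<^esub>}"
        by (auto simp: direct_sum_family_def intro: finite_subset)
      moreover have "\<And>i. i \<in> I \<Longrightarrow> v i \<oplus>\<^bsub>M i\<^esub> w i \<in> carrier (M i)"
        using vw by (auto simp: direct_sum_family_def intro!: abelian_monoid.a_closed[OF monoids])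
      ultimately show "v \<oplus>\<^bsub>direct_sum_family I M\<^esub> w \<in> carrier (direct_sum_family I M)"
        by (simp add: direct_sum_family_def cong: conj_cong)
    qed
  next
    case 3
    show ?case
    proof
      fix v assume v: "v \<in> carrier (direct_sum_family I M)"
      have neg: "\<ominus>\<^bsub>M i\<^esub> v i \<in> carrier (M i)" "v i \<oplus>\<^bsub>M i\<^esub> (\<ominus>\<^bsub>M i\<^esub> v i) = \<zero>\<^bsub>M i\<^esub>" if "i \<in> I" for i
        using v that
        by (auto simp: direct_sum_family_def
            intro!: abelian_group.a_inv_closed[OF groups] abelian_group.r_neg[OF groups])
      have "{i \<in> I. \<ominus>\<^bsub>M i\<^esub> v i \<noteq> \<zero>\<^bsub>M i\<^esub>} \<subseteq> {i \<in> I. v i \<noteq> \<zero>\<^bsub>M i\<^esub>}"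
      proof safe
        fix i assume i: "i \<in> I" and "\<ominus>\<^bsub>M i\<^esub> v i \<noteq> \<zero>\<^bsub>M i\<^esub>" "v i = \<zero>\<^bsub>M i\<^esub>"
        interpret module R "M i" by (rule M[OF i])
        from \<open>v i = \<zero>\<^bsub>M i\<^esub>\<close> \<open>\<ominus>\<^bsub>M i\<^esub> v i \<noteq> \<zero>\<^bsub>M i\<^esub>\<close> show False by simp
      qed
      with v have "finite {i \<in> I. \<ominus>\<^bsub>M i\<^esub> v i \<noteq> \<zero>\<^bsub>M i\<^esub>}"
        by (auto simp: direct_sum_family_def intro: finite_subset)
      with neg show "\<exists>w\<in>carrier (direct_sum_family I M).
          v \<oplus>\<^bsub>direct_sum_family I M\<^esub> w = \<zero>\<^bsub>direct_sum_family I M\<^esub>"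
        by (intro bexI[of _ "\<lambda>i\<in>I. \<ominus>\<^bsub>M i\<^esub> v i"])
          (auto simp: direct_sum_family_def cong: conj_cong)
    qed
  next
    case 4
    show ?case
    proof (intro allI impI)
      fix c v
      assume cv: "c \<in> carrier R \<and> v \<in> carrier (direct_sum_family I M)"
      have "{i \<in> I. c \<odot>\<^bsub>M i\<^esub> v i \<noteq> \<zero>\<^bsub>M i\<^esub>} \<subseteq> {i \<in> I. v i \<noteq> \<zero>\<^bsub>M i\<^esub>}"
      proof safe
        fix i assume i: "i \<in> I" and *: "c \<odot>\<^bsub>M i\<^esub> v i \<noteq> \<zero>\<^bsub>M i\<^esub>" "v i = \<zero>\<^bsub>M i\<^esub>"
        interpret module R "M i" by (rule M[OF i])
        from * cv show False by (simp add: smult_r_null)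
      qed
      with cv have "finite {i \<in> I. c \<odot>\<^bsub>M i\<^esub> v i \<noteq> \<zero>\<^bsub>M i\<^esub>}"
        by (auto simp: direct_sum_family_def intro: finite_subset)
      moreover have "\<And>i. i \<in> I \<Longrightarrow> c \<odot>\<^bsub>M i\<^esub> v i \<in> carrier (M i)"
        using cv by (auto simp: direct_sum_family_def intro!: module.smult_closed[OF M])
      ultimately show "c \<odot>\<^bsub>direct_sum_family I M\<^esub> v \<in> carrier (direct_sum_family I M)"
        by (simp add: direct_sum_family_def cong: conj_cong)
    qed
  next
    case 5
    show ?case
      by (auto simp: direct_sum_family_def intro!: restrict_ext abelian_monoid.a_comm[OF monoids])
  next
    case 6
    show ?case
      by (auto simp: direct_sum_family_def intro!: restrict_ext abelian_monoid.a_assoc[OF monoids])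
  next
    case 7
    show ?case
    proof
      fix v assume v: "v \<in> carrier (direct_sum_family I M)"
      have "v i \<oplus>\<^bsub>M i\<^esub> \<zero>\<^bsub>M i\<^esub> = v i" if "i \<in> I" for i
        using v that
        by (auto simp: direct_sum_family_def intro!: abelian_monoid.r_zero[OF monoids])
      \<comment> \<open>The operations return functions restricted to \<open>I\<close>, so the
        coordinatewise law gives only \<open>restrict v I\<close>; this is \<open>v\<close> because
        elements of the carrier are extensional.\<close>
      then have "v \<oplus>\<^bsub>direct_sum_family I M\<^esub> \<zero>\<^bsub>direct_sum_family I M\<^esub> = restrict v I"
        by (auto simp: direct_sum_family_def intro!: restrict_ext)
      also have "\<dots> = v"
        using v by (auto simp: direct_sum_family_def intro: PiE_restrict)
      finally show "v \<oplus>\<^bsub>direct_sum_family I M\<^esub> \<zero>\<^bsub>direct_sum_family I M\<^esub> = v" .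
    qed
  next
    case 8
    show ?case
      by (auto simp: direct_sum_family_def intro!: restrict_ext module.smult_assoc1[OF M])
  next
    case 9
    show ?case
    proof
      fix v assume v: "v \<in> carrier (direct_sum_family I M)"
      have "\<one>\<^bsub>R\<^esub> \<odot>\<^bsub>M i\<^esub> v i = v i" if "i \<in> I" for i
        using v that by (auto simp: direct_sum_family_def intro!: module.smult_one[OF M])
      then have "\<one>\<^bsub>R\<^esub> \<odot>\<^bsub>direct_sum_family I M\<^esub> v = restrict v I"
        by (auto simp: direct_sum_family_def intro!: restrict_ext)
      also have "\<dots> = v"
        using v by (auto simp: direct_sum_family_def intro: PiE_restrict)
      finally show "\<one>\<^bsub>R\<^esub> \<odot>\<^bsub>direct_sum_family I M\<^esub> v = v" .
    qed
  next
    case 10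
    show ?case
      by (auto simp: direct_sum_family_def intro!: restrict_ext module.smult_l_distr[OF M])
  next
    case 11
    show ?case
      by (auto simp: direct_sum_family_def intro!: restrict_ext module.smult_r_distr[OF M])
  qed
qed

lemma summand_embedding_closed:
  assumes "\<And>j. j \<in> I \<Longrightarrow> module R (M j)" and "v \<in> carrier (M i)"
  shows "summand_embedding I M i v \<in> carrier (direct_sum_family I M)"
proof -
  have "finite {j \<in> I. summand_embedding I M i v j \<noteq> \<zero>\<^bsub>M j\<^esub>}"
    by (rule finite_subset[of _ "{i}"]) (auto simp: summand_embedding_def)
  moreover have "\<zero>\<^bsub>M j\<^esub> \<in> carrier (M j)" if "j \<in> I" for j
    using assms(1)[OF that] by (simp add: module_def abelian_group_def abelian_monoid.zero_closed)
  ultimately show ?thesis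
    using assms(2) by (auto simp: direct_sum_family_def summand_embedding_def)
qed

section \<open>Change of index set\<close>

text \<open>Pullback along the index map, hence contravariant: the map of direct sums induced by a
  bijection of indices is \<open>reindex\<close> along the inverse bijection.\<close>

definition reindex :: "'j set \<Rightarrow> ('j \<Rightarrow> 'i) \<Rightarrow> ('i \<Rightarrow> 'v) \<Rightarrow> 'j \<Rightarrow> 'v" where
  "reindex J \<phi> f = (\<lambda>j\<in>J. f (\<phi> j))"

text \<open>Injectivity keeps the support finite: \<open>\<phi>\<close> embeds the support of the
  pullback into the support of \<open>f\<close>.\<close>

lemma reindex_closed:
  assumes \<phi>: "\<phi> \<in> J \<rightarrow> I" "inj_on \<phi> J"
    and M: "\<And>j. j \<in> J \<Longrightarrow> M' j = M (\<phi> j)"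
    and f: "f \<in> carrier (direct_sum_family I M)"
  shows "reindex J \<phi> f \<in> carrier (direct_sum_family J M')"
proof -
  have "\<phi> ` {j \<in> J. f (\<phi> j) \<noteq> \<zero>\<^bsub>M (\<phi> j)\<^esub>} \<subseteq> {i \<in> I. f i \<noteq> \<zero>\<^bsub>M i\<^esub>}"
    using \<phi> by auto
  with f have "finite (\<phi> ` {j \<in> J. f (\<phi> j) \<noteq> \<zero>\<^bsub>M (\<phi> j)\<^esub>})"
    by (auto simp: direct_sum_family_def intro: finite_subset)
  then have "finite {j \<in> J. f (\<phi> j) \<noteq> \<zero>\<^bsub>M (\<phi> j)\<^esub>}"
    by (rule finite_imageD) (auto intro: inj_on_subset[OF \<phi>(2)])
  moreover have "f (\<phi> j) \<in> carrier (M (\<phi> j))" if "j \<in> J" for j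
    using f \<phi>(1) that by (auto simp: direct_sum_family_def)
  ultimately show ?thesis
    using M by (auto simp: direct_sum_family_def reindex_def cong: conj_cong)
qed

lemma mod_hom_reindex:
  assumes R: "cring R"
    and M_mod: "\<And>i. i \<in> I \<Longrightarrow> module R (M i)"
    and \<phi>: "\<phi> \<in> J \<rightarrow> I" "inj_on \<phi> J"
    and M: "\<And>j. j \<in> J \<Longrightarrow> M' j = M (\<phi> j)"
  shows "mod_hom R (direct_sum_family I M) (direct_sum_family J M') (reindex J \<phi>)"
proof (intro mod_hom.intro mod_hom_axioms.intro module_direct_sum_family R)
  show "module R (M i)" if "i \<in> I" for i using M_mod that .
  show "module R (M' j)" if "j \<in> J" for j using M_mod M \<phi>(1) that by auto
  show "reindex J \<phi> \<in> module_hom R (direct_sum_family I M) (direct_sum_family J M')"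
    unfolding module_hom_def
  proof (intro CollectI conjI allI impI funcsetI)
    show "reindex J \<phi> f \<in> carrier (direct_sum_family J M')"
      if "f \<in> carrier (direct_sum_family I M)" for f
      using reindex_closed[where M = M and \<phi> = \<phi>, OF \<phi> M that] .
    show "reindex J \<phi> (f \<oplus>\<^bsub>direct_sum_family I M\<^esub> g)
        = reindex J \<phi> f \<oplus>\<^bsub>direct_sum_family J M'\<^esub> reindex J \<phi> g" for f g
      using funcset_mem[OF \<phi>(1)] by (simp add: direct_sum_family_def reindex_def M cong: restrict_cong)
    show "reindex J \<phi> (c \<odot>\<^bsub>direct_sum_family I M\<^esub> f)
        = c \<odot>\<^bsub>direct_sum_family J M'\<^esub> reindex J \<phi> f" for c f
      using funcset_mem[OF \<phi>(1)] by (simp add: direct_sum_family_def reindex_def M cong: restrict_cong)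
  qed
qed

text \<open>The composite is restriction to \<open>I\<close>, which fixes extensional functions.
  Used in both directions, this makes mutually inverse index maps induce mutually inverse maps of
  direct sums.\<close>

lemma reindex_reindex:
  assumes "\<psi> \<in> I \<rightarrow> J" and "\<And>i. i \<in> I \<Longrightarrow> \<phi> (\<psi> i) = i"
    and "f \<in> carrier (direct_sum_family I M)"
  shows "reindex I \<psi> (reindex J \<phi> f) = f"
proof -
  have "reindex I \<psi> (reindex J \<phi> f) = restrict f I"
    using assms(1,2) by (auto simp: reindex_def intro!: restrict_ext)
  then show ?thesis
    using assms(3) by (auto simp: direct_sum_family_def intro: PiE_restrict)
qed

section \<open>Spans, quotients and induced isomorphisms\<close>

text \<open>Both inclusions come from minimality of a span: the preimage of the span of
  \<open>f\<close>
  S\<open>is a submodule containing\<close>S\<open>, and the image of the span of\<close>S\<open>is a submodule containing\<close>f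
  \<open>S\<close>.\<close>

lemma (in mod_hom) span_image:
  assumes S: "S \<subseteq> carrier M"
  shows "f ` module.span R M S = module.span R N (f ` S)"
proof
  have fS: "f ` S \<subseteq> carrier N" using S by auto
  interpret span: submodule R "M.span S" M by (rule M.span_is_submodule[OF S])
  interpret fspan: submodule R "N.span (f ` S)" N by (rule N.span_is_submodule[OF fS])
  have "submodule R {v \<in> carrier M. f v \<in> N.span (f ` S)} M"
    by (rule submodule.intro) (auto intro: M.module_axioms)
  moreover have "S \<subseteq> {v \<in> carrier M. f v \<in> N.span (f ` S)}"
    using S N.in_own_span[OF fS] by auto
  ultimately show "f ` M.span S \<subseteq> N.span (f ` S)"
    using M.span_is_subset by blast
  have "submodule R (f ` M.span S) N"
  proof (rule submodule.intro)
    show "module R N" by (rule N.module_axioms)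
    show "f ` M.span S \<subseteq> carrier N" using span.subset by auto
    show "v \<oplus>\<^bsub>N\<^esub> w \<in> f ` M.span S" if "v \<in> f ` M.span S" "w \<in> f ` M.span S" for v w
    proof -
      from that obtain a b where ab: "a \<in> M.span S" "b \<in> M.span S" "v = f a" "w = f b" by blast
      then have "v \<oplus>\<^bsub>N\<^esub> w = f (a \<oplus>\<^bsub>M\<^esub> b)" using span.subset by (simp add: subset_iff)
      with ab show ?thesis by auto
    qed
    show "\<zero>\<^bsub>N\<^esub> \<in> f ` M.span S"
      by (rule image_eqI[of _ _ "\<zero>\<^bsub>M\<^esub>"]) auto
    show "c \<odot>\<^bsub>N\<^esub> v \<in> f ` M.span S" if "c \<in> carrier R" "v \<in> f ` M.span S" for c v
    proof -
      from that obtain a where a: "a \<in> M.span S" "v = f a" by blast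
      then have "c \<odot>\<^bsub>N\<^esub> v = f (c \<odot>\<^bsub>M\<^esub> a)" using span.subset that(1) by (simp add: subset_iff)
      with a that(1) show ?thesis by auto
    qed
  qed
  moreover have "f ` S \<subseteq> f ` M.span S"
    using M.in_own_span[OF S] by auto
  ultimately show "N.span (f ` S) \<subseteq> f ` M.span S"
    by (intro N.span_is_subset)
qed

text \<open>Negatives are multiples by minus one. The lemma makes the library's calculus of additive
  cosets available for submodules.\<close>

lemma submodule_abelian_subgroup:
  assumes "submodule R N M"
  shows "abelian_subgroup N M"
proof -
  interpret submodule R N M by (rule assms)
  interpret module R M by (rule module)
  have neg: "\<ominus>\<^bsub>M\<^esub> v \<in> N" if "v \<in> N" for v
  proof -
    have "\<ominus>\<^bsub>M\<^esub> v = (\<ominus>\<^bsub>R\<^esub> \<one>\<^bsub>R\<^esub>) \<odot>\<^bsub>M\<^esub> v"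
      using that subset by (simp add: smult_minus_1 subset_iff)
    with that show ?thesis by simp
  qed
  have "N \<noteq> {}" using submodule.zero_closed[OF assms] by blast
  then have "subgroup N (add_monoid M)"
    by (intro M.add.subgroupI) (use subset neg in auto)
  then show ?thesis
    by (intro abelian_subgroupI3 additive_subgroup.intro M.abelian_group_axioms)
qed

text \<open>Well-definedness of the quotient's scalar multiplication, which is a union over all
  representatives: two of them differ by an element of \<open>N\<close>, so their multiples differ
  by one too and every term of the union is the same coset.\<close>

lemma coset_smult:
  assumes N: "submodule R N M" and c: "c \<in> carrier R" and a: "a \<in> carrier M"
  shows "c \<odot>\<^bsub>quotient_module M N\<^esub> (N +>\<^bsub>M\<^esub> a) = N +>\<^bsub>M\<^esub> (c \<odot>\<^bsub>M\<^esub> a)"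
proof -
  interpret submodule R N M by (rule N)
  interpret module R M by (rule module)
  interpret abelian_subgroup N M by (rule submodule_abelian_subgroup[OF N])
  have "N +>\<^bsub>M\<^esub> (c \<odot>\<^bsub>M\<^esub> b) = N +>\<^bsub>M\<^esub> (c \<odot>\<^bsub>M\<^esub> a)" if "b \<in> N +>\<^bsub>M\<^esub> a" for b
  proof -
    from that obtain n where n: "n \<in> N" "b = n \<oplus>\<^bsub>M\<^esub> a" by (auto simp: a_r_coset_def')
    have nM: "n \<in> carrier M" using n subset by auto
    have "c \<odot>\<^bsub>M\<^esub> b = c \<odot>\<^bsub>M\<^esub> n \<oplus>\<^bsub>M\<^esub> c \<odot>\<^bsub>M\<^esub> a"
      using n nM a c by (simp add: smult_r_distr)
    then have "c \<odot>\<^bsub>M\<^esub> b \<in> N +>\<^bsub>M\<^esub> (c \<odot>\<^bsub>M\<^esub> a)"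
      using n c by (auto simp: a_r_coset_def')
    then show ?thesis
      using a c M.a_repr_independence[OF _ _ a_subgroup] by simp
  qed
  \<comment> \<open>The union has a nonempty index set, so it equals the common coset and not the
    empty set.\<close>
  moreover have "a \<in> N +>\<^bsub>M\<^esub> a" by (rule a_rcos_self[OF a])
  ultimately have "(\<Union>b\<in>N +>\<^bsub>M\<^esub> a. N +>\<^bsub>M\<^esub> (c \<odot>\<^bsub>M\<^esub> b)) = N +>\<^bsub>M\<^esub> (c \<odot>\<^bsub>M\<^esub> a)"
    by blast
  then show ?thesis by (simp add: quotient_module_def)
qed

text \<open>Once zero, sum and scalar multiple are expressed through representatives, each axiom
  reduces to the same axiom in \<open>M\<close>.\<close>

lemma module_quotient_module:
  assumes N: "submodule R N M"
  shows "module R (quotient_module M N)"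
proof -
  interpret submodule R N M by (rule N)
  interpret module R M by (rule module)
  interpret abelian_subgroup N M by (rule submodule_abelian_subgroup[OF N])
  have carrier_eq: "carrier (quotient_module M N) = (\<lambda>a. N +>\<^bsub>M\<^esub> a) ` carrier M"
    by (auto simp: quotient_module_def A_RCOSETS_def')
  have zero_eq: "\<zero>\<^bsub>quotient_module M N\<^esub> = N +>\<^bsub>M\<^esub> \<zero>\<^bsub>M\<^esub>"
    using subset by (simp add: quotient_module_def)
  have add_eq: "(N +>\<^bsub>M\<^esub> a) \<oplus>\<^bsub>quotient_module M N\<^esub> (N +>\<^bsub>M\<^esub> b) = N +>\<^bsub>M\<^esub> (a \<oplus>\<^bsub>M\<^esub> b)"
    if "a \<in> carrier M" "b \<in> carrier M" for a b
    using a_rcos_sum[OF that] by (simp add: quotient_module_def)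
  note simps = carrier_eq zero_eq add_eq coset_smult[OF N]
  show ?thesis
  proof (rule module_criteria[OF R.cring_axioms], goal_cases)
    case 3
    show ?case
    proof
      fix A assume "A \<in> carrier (quotient_module M N)"
      then obtain a where a: "a \<in> carrier M" "A = N +>\<^bsub>M\<^esub> a" by (auto simp: carrier_eq)
      show "\<exists>B\<in>carrier (quotient_module M N).
          A \<oplus>\<^bsub>quotient_module M N\<^esub> B = \<zero>\<^bsub>quotient_module M N\<^esub>"
        using a by (intro bexI[of _ "N +>\<^bsub>M\<^esub> (\<ominus>\<^bsub>M\<^esub> a)"]) (auto simp: simps M.r_neg)
    qed
  qed (auto simp: simps M.a_ac smult_l_distr smult_r_distr smult_assoc1)
qed

lemma vectorspace_isomorphic_quotient_module:
  assumes K: "field K" and h: "mod_hom K V W h"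
    and bij: "bij_betw h (carrier V) (carrier W)"
    and N: "submodule K N V" and N': "submodule K N' W" and image: "h ` N = N'"
  shows "vectorspace_isomorphic K (quotient_module V N) (quotient_module W N')"
proof -
  interpret mod_hom K V W h by (rule h)
  interpret field K by (rule K)
  interpret N: submodule K N V by (rule N)
  interpret N: abelian_subgroup N V by (rule submodule_abelian_subgroup[OF N])
  interpret N': abelian_subgroup N' W by (rule submodule_abelian_subgroup[OF N'])
  let ?V = "quotient_module V N" and ?W = "quotient_module W N'"
  interpret QV: vectorspace K ?V
    by (intro vectorspace.intro module_quotient_module N K)
  interpret QW: vectorspace K ?W
    by (intro vectorspace.intro module_quotient_module N' K)
  have carV: "carrier ?V = (\<lambda>a. N +>\<^bsub>V\<^esub> a) ` carrier V"
    and carW: "carrier ?W = (\<lambda>a. N' +>\<^bsub>W\<^esub> a) ` carrier W"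
    by (auto simp: quotient_module_def A_RCOSETS_def')
  have coset: "h ` (N +>\<^bsub>V\<^esub> a) = N' +>\<^bsub>W\<^esub> h a" if "a \<in> carrier V" for a
  proof -
    have "h (n \<oplus>\<^bsub>V\<^esub> a) = h n \<oplus>\<^bsub>W\<^esub> h a" if "n \<in> N" for n
      using that \<open>a \<in> carrier V\<close> N.subset by auto
    then show ?thesis
      by (simp add: a_r_coset_def' image_UN flip: image)
  qed
  have "(`) h \<in> module_hom K ?V ?W"
    unfolding module_hom_def
  proof (intro CollectI conjI allI impI)
    show "(`) h \<in> carrier ?V \<rightarrow> carrier ?W"
      by (auto simp: carV carW coset)
  next
    fix A B assume "A \<in> carrier ?V \<and> B \<in> carrier ?V"
    then obtain a b where "a \<in> carrier V" "b \<in> carrier V" "A = N +>\<^bsub>V\<^esub> a" "B = N +>\<^bsub>V\<^esub> b"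
      by (auto simp: carV)
    then show "h ` (A \<oplus>\<^bsub>?V\<^esub> B) = h ` A \<oplus>\<^bsub>?W\<^esub> h ` B"
      by (simp add: quotient_module_def N.a_rcos_sum N'.a_rcos_sum coset)
  next
    fix c A assume "c \<in> carrier K \<and> A \<in> carrier ?V"
    then obtain a where "c \<in> carrier K" "a \<in> carrier V" "A = N +>\<^bsub>V\<^esub> a"
      by (auto simp: carV)
    then show "h ` (c \<odot>\<^bsub>?V\<^esub> A) = c \<odot>\<^bsub>?W\<^esub> (h ` A)"
      by (simp add: coset_smult[OF N] coset_smult[OF N'] coset)
  qed
  then have "linear_map K ?V ?W ((`) h)"
    by (intro linear_map.intro mod_hom.intro mod_hom_axioms.intro QV.vectorspace_axioms
        QW.vectorspace_axioms QV.module_axioms QW.module_axioms)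
  moreover have "bij_betw ((`) h) (carrier ?V) (carrier ?W)"
  proof (rule bij_betw_imageI)
    \<comment> \<open>Taking images is injective on the subsets of a set on which \<open>h\<close>
      is injective.\<close>
    have "carrier ?V \<subseteq> Pow (carrier V)"
      using N.subset by (auto simp: carV a_r_coset_def')
    then show "inj_on ((`) h) (carrier ?V)"
      by (rule inj_on_subset[OF inj_on_image_Pow[OF bij_betw_imp_inj_on[OF bij]]])
    have "(`) h ` carrier ?V = (\<lambda>b. N' +>\<^bsub>W\<^esub> b) ` h ` carrier V"
      by (simp add: carV image_image coset)
    then show "(`) h ` carrier ?V = carrier ?W"
      using bij by (simp add: carW bij_betw_imp_surj_on)
  qed
  ultimately show ?thesis
    unfolding vectorspace_isomorphic_def by blast
qed

section \<open>The real field and the direct sum of tangent spaces\<close>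

lemma cring_real_field: "cring real_field"
proof -
  have "\<exists>b. b + a = 0" for a :: real
    by (rule exI[of _ "- a"]) simp
  then show ?thesis
    unfolding real_field_def
    by (intro cringI abelian_groupI comm_monoidI) (auto simp: distrib_right)
qed

lemma field_real_field: "field real_field"
proof -
  have "\<exists>b. a * b = 1" if "a \<noteq> 0" for a :: real
    using that by (intro exI[of _ "inverse a"]) simp
  then show ?thesis
    by (intro cring.cring_fieldI2 cring_real_field) (auto simp: real_field_def)
qed

lemma module_euclidean_tangent_space: "module real_field (euclidean_tangent_space n)"
proof (rule module_criteria, goal_cases)
  case 1
  show ?case by (rule cring_real_field)
next
  \<comment> \<open>Here the ring hypothesis is itself the first goal, which shifts the existence of
    additive inverses to the fourth.\<close>
  case 4
  show ?case
  proof
    fix v assume "v \<in> carrier (euclidean_tangent_space n)"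
    then show "\<exists>w\<in>carrier (euclidean_tangent_space n).
        v \<oplus>\<^bsub>euclidean_tangent_space n\<^esub> w = \<zero>\<^bsub>euclidean_tangent_space n\<^esub>"
      by (intro bexI[of _ "\<lambda>i. - v i"])
        (auto simp: euclidean_tangent_space_def topspace_Euclidean_space)
  qed
qed (simp_all add: euclidean_tangent_space_def topspace_Euclidean_space real_field_def
    add_ac mult.assoc distrib_left distrib_right)

lemma module_plot_tangent_space: "module real_field (plot_tangent_space P)"
  by (cases P) (simp add: module_euclidean_tangent_space)

lemma module_tangent_sum: "module real_field (tangent_sum D x)"
  unfolding tangent_sum_def
  by (rule module_direct_sum_family[OF cring_real_field module_plot_tangent_space])

lemma tangent_vector_closed:
  assumes "v \<in> carrier (plot_tangent_space P)"
  shows "tangent_vector D x P v \<in> carrier (tangent_sum D x)"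
  unfolding tangent_vector_def tangent_sum_def
  by (rule summand_embedding_closed[where M = plot_tangent_space, OF module_plot_tangent_space assms])

text \<open>The default value \<open>0\<close> at indices from \<open>m\<close> onwards is exactly
  what membership in \<open>Euclidean_space m\<close> requires.\<close>

lemma differential_at_closed:
  "differential_at n m g a v \<in> carrier (euclidean_tangent_space m)"
  by (auto simp: differential_at_def euclidean_tangent_space_def topspace_Euclidean_space)

text \<open>Needed wherever the span of the relations is to be treated as a submodule.\<close>

lemma tangent_relations_closed: "tangent_relations D x \<subseteq> carrier (tangent_sum D x)"
proof -
  interpret module real_field "tangent_sum D x" by (rule module_tangent_sum)
  show ?thesis
    by (auto simp: tangent_relations_def
        intro!: M.minus_closed tangent_vector_closed differential_at_closed)
qed

section \<open>Pushing plots and tangent relations forward\<close>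

text \<open>Using \<open>compose\<close> instead of plain composition keeps the map extensional, so
  that the result can again be an index of the direct sum.\<close>

definition pushforward_plot :: "('a \<Rightarrow> 'b) \<Rightarrow> 'a parametrization \<Rightarrow> 'b parametrization" where
  "pushforward_plot f = (\<lambda>(n, U, p). (n, U, compose U f p))"

lemma pushforward_plot_in_pointed_plots:
  assumes "diffeological_smooth X DX Y DY f" and "P \<in> pointed_plots DX x"
  shows "pushforward_plot f P \<in> pointed_plots DY (f x)"
  using assms
  by (auto simp: diffeological_smooth_def pointed_plots_def pushforward_plot_def compose_def)

text \<open>Plots take values in \<open>X\<close>, where \<open>g\<close> undoes \<open>f\<close>,
  so the double composite is \<open>restrict p U\<close>. Extensionality of \<open>p\<close> turns
  this into equality of triples.\<close>

lemma pushforward_plot_inverse: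
  assumes "diffeological_space X DX" and "P \<in> pointed_plots DX x"
    and "\<And>x. x \<in> X \<Longrightarrow> g (f x) = x"
  shows "pushforward_plot g (pushforward_plot f P) = P"
proof -
  obtain n U p where P: "P = (n, U, p)" by (cases P)
  with assms(1,2) have p: "p \<in> U \<rightarrow>\<^sub>E X"
    by (auto simp: pointed_plots_def diffeological_space_def parametrizations_def)
  then have "compose U g (compose U f p) = restrict p U"
    using assms(3) by (auto simp: fun_eq_iff compose_def restrict_def)
  with p show ?thesis
    by (simp add: P pushforward_plot_def PiE_restrict)
qed

text \<open>A vector concentrated at \<open>P\<close> pulls back to one concentrated at the only
  possible preimage \<open>P'\<close> of \<open>P\<close>.\<close>

lemma reindex_tangent_vector:
  assumes \<phi>: "\<phi> \<in> pointed_plots DY y \<rightarrow> pointed_plots DX x"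
    and P': "\<And>Q. Q \<in> pointed_plots DY y \<Longrightarrow> \<phi> Q = P \<longleftrightarrow> Q = P'"
  shows "reindex (pointed_plots DY y) \<phi> (tangent_vector DX x P v) = tangent_vector DY y P' v"
proof -
  \<comment> \<open>All summands share the same zero whatever their dimension, so the values away
    from \<open>P\<close> and \<open>P'\<close> agree.\<close>
  have zero: "\<zero>\<^bsub>plot_tangent_space Q\<^esub> = (\<lambda>i. 0)" for Q :: "'c parametrization"
    by (simp add: euclidean_tangent_space_def split: prod.split)
  have "tangent_vector DX x P v (\<phi> Q) = tangent_vector DY y P' v Q"
    if Q: "Q \<in> pointed_plots DY y" for Q
    using Q P'[OF Q] funcset_mem[OF \<phi> Q]
    by (simp add: tangent_vector_def summand_embedding_def zero)
  then show ?thesis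
    by (auto simp: fun_eq_iff reindex_def tangent_vector_def summand_embedding_def)
qed

text \<open>Only an inclusion is claimed; exchanging the roles of \<open>f\<close> and
  \<open>g\<close> later supplies the converse.\<close>

lemma reindex_tangent_relations:
  assumes X: "diffeological_space X DX" and Y: "diffeological_space Y DY"
    and f: "diffeological_smooth X DX Y DY f" and g: "diffeological_smooth Y DY X DX g"
    and gf: "\<And>x. x \<in> X \<Longrightarrow> g (f x) = x" and fg: "\<And>y. y \<in> Y \<Longrightarrow> f (g y) = y"
    and x: "x \<in> X"
    and hom: "mod_hom real_field (tangent_sum DX x) (tangent_sum DY (f x))
      (reindex (pointed_plots DY (f x)) (pushforward_plot g))"
  shows "reindex (pointed_plots DY (f x)) (pushforward_plot g) ` tangent_relations DX x
    \<subseteq> tangent_relations DY (f x)"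
proof safe
  let ?h = "reindex (pointed_plots DY (f x)) (pushforward_plot g)"
  interpret mod_hom real_field "tangent_sum DX x" "tangent_sum DY (f x)" ?h by (rule hom)
  fix r assume "r \<in> tangent_relations DX x"
  then obtain n U p m W q v V k where
    r: "r = tangent_vector DX x (n, U, p) v \<ominus>\<^bsub>tangent_sum DX x\<^esub>
      tangent_vector DX x (m, W, q) (differential_at n m k (\<lambda>_. 0) v)"
    and p: "(n, U, p) \<in> pointed_plots DX x" and q: "(m, W, q) \<in> pointed_plots DX x"
    and v: "v \<in> carrier (euclidean_tangent_space n)"
    and V: "openin (Euclidean_space n) V" "(\<lambda>_. 0) \<in> V" "V \<subseteq> U"
    and k: "smooth_map n V m W k" "k (\<lambda>_. 0) = (\<lambda>_. 0)" and pqk: "\<forall>u\<in>V. p u = q (k u)"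
    unfolding tangent_relations_def by blast
  have h_r: "?h r = ?h (tangent_vector DX x (n, U, p) v) \<ominus>\<^bsub>tangent_sum DY (f x)\<^esub>
      ?h (tangent_vector DX x (m, W, q) (differential_at n m k (\<lambda>_. 0) v))"
    unfolding r using v by (intro f_minus tangent_vector_closed) (simp_all add: differential_at_closed)
  \<comment> \<open>Pulling back along the pushforward by \<open>g\<close> moves the summand at
    \<open>P\<close> to the unique \<open>Q\<close> that \<open>g\<close> carries to
    \<open>P\<close>, namely the pushforward of \<open>P\<close> by \<open>f\<close>.\<close>
  have h_vec: "?h (tangent_vector DX x P w) = tangent_vector DY (f x) (pushforward_plot f P) w"
    if P: "P \<in> pointed_plots DX x" for P w
  proof (rule reindex_tangent_vector)
    show "pushforward_plot g \<in> pointed_plots DY (f x) \<rightarrow> pointed_plots DX x"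
      using pushforward_plot_in_pointed_plots[OF g, of _ "f x"] gf[OF x] by auto
    show "pushforward_plot g Q = P \<longleftrightarrow> Q = pushforward_plot f P"
      if "Q \<in> pointed_plots DY (f x)" for Q
      using pushforward_plot_inverse[where f = f and g = g, OF X P gf]
        pushforward_plot_inverse[where f = g and g = f, OF Y that fg] by auto
  qed
  have "?h r = tangent_vector DY (f x) (n, U, compose U f p) v \<ominus>\<^bsub>tangent_sum DY (f x)\<^esub>
      tangent_vector DY (f x) (m, W, compose W f q) (differential_at n m k (\<lambda>_. 0) v)"
    unfolding h_r h_vec[OF p] h_vec[OF q] by (simp add: pushforward_plot_def)
  moreover have "(n, U, compose U f p) \<in> pointed_plots DY (f x)"
    "(m, W, compose W f q) \<in> pointed_plots DY (f x)"
    using pushforward_plot_in_pointed_plots[OF f p] pushforward_plot_in_pointed_plots[OF f q]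
    by (simp_all add: pushforward_plot_def)
  \<comment> \<open>Since \<open>V\<close> lies in \<open>U\<close> and \<open>k\<close> maps
    \<open>V\<close> into \<open>W\<close>, neither side takes the default value
    \<open>undefined\<close> of \<open>compose\<close>.\<close>
  moreover have "\<forall>u\<in>V. compose U f p u = compose W f q (k u)"
    using pqk V(3) k(1) by (auto simp: compose_def smooth_map_def Pi_iff subset_iff)
  ultimately show "?h r \<in> tangent_relations DY (f x)"
    using v V k unfolding tangent_relations_def by blast
qed

section \<open>The isomorphism of tangent spaces induced by a diffeomorphism\<close>

theorem theorem4p4:
  fixes X :: "'a set" and DX :: "'a parametrization set"
    and Y :: "'b set" and DY :: "'b parametrization set"
    and chi :: "'a \<Rightarrow> 'b" and x :: 'a and y :: 'b
  assumes "diffeological_space X DX"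
    and "diffeological_space Y DY"
    and "diffeological_diffeomorphism X DX Y DY chi"
    and "x \<in> X"
    and "y = chi x"
  shows "vectorspace_isomorphic real_field
           (internal_tangent_space DX x) (internal_tangent_space DY y)"
proof -
  note X = assms(1) and Y = assms(2)
  from assms(3) obtain g where chi: "diffeological_smooth X DX Y DY chi"
    and g: "diffeological_smooth Y DY X DX g"
    and g_chi: "\<And>x. x \<in> X \<Longrightarrow> g (chi x) = x" and chi_g: "\<And>y. y \<in> Y \<Longrightarrow> chi (g y) = y"
    unfolding diffeological_diffeomorphism_def by blast
  have y: "y \<in> Y" and gy: "g y = x"
    using chi assms(4,5) g_chi by (auto simp: diffeological_smooth_def)
  let ?I = "pointed_plots DX x" and ?J = "pointed_plots DY y"
  let ?to = "pushforward_plot chi" and ?from = "pushforward_plot g"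
  \<comment> \<open>By contravariance \<open>?h\<close>, built from \<open>g\<close>, goes from the
    sum at \<open>x\<close> to the sum at \<open>y\<close>, and \<open>?h'\<close>, built from
    \<open>chi\<close>, goes back.\<close>
  let ?h = "reindex ?J ?from" and ?h' = "reindex ?I ?to"
  have to_from: "?to (?from Q) = Q" if "Q \<in> ?J" for Q
    using pushforward_plot_inverse[where f = g and g = chi, OF Y that chi_g] .
  have from_to: "?from (?to P) = P" if "P \<in> ?I" for P
    using pushforward_plot_inverse[where f = chi and g = g, OF X that g_chi] .
  have to: "?to \<in> ?I \<rightarrow> ?J" "inj_on ?to ?I"
    using pushforward_plot_in_pointed_plots[OF chi] assms(5)
    by (auto intro!: inj_on_inverseI[of ?I ?from] from_to)
  have "from": "?from \<in> ?J \<rightarrow> ?I" "inj_on ?from ?J"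
    using pushforward_plot_in_pointed_plots[OF g] gy
    by (auto intro!: inj_on_inverseI[of ?J ?to] to_from)
  \<comment> \<open>A summand depends only on the dimension of the plot's domain, which composition
    leaves alone.\<close>
  have fibres: "plot_tangent_space P = plot_tangent_space (pushforward_plot f P)"
    for P :: "'c parametrization" and f :: "'c \<Rightarrow> 'd"
    by (auto simp: pushforward_plot_def split: prod.split)
  have h: "mod_hom real_field (tangent_sum DX x) (tangent_sum DY y) ?h"
    unfolding tangent_sum_def
    by (rule mod_hom_reindex[where M = plot_tangent_space and M' = plot_tangent_space and \<phi> = ?from,
          OF cring_real_field module_plot_tangent_space "from" fibres])
  have h': "mod_hom real_field (tangent_sum DY y) (tangent_sum DX x) ?h'"
    unfolding tangent_sum_def
    by (rule mod_hom_reindex[where M = plot_tangent_space and M' = plot_tangent_space and \<phi> = ?to,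
          OF cring_real_field module_plot_tangent_space to fibres])
  interpret h: mod_hom real_field "tangent_sum DX x" "tangent_sum DY y" ?h by (rule h)
  interpret h': mod_hom real_field "tangent_sum DY y" "tangent_sum DX x" ?h' by (rule h')
  have h'_h: "?h' (?h u) = u" if "u \<in> carrier (tangent_sum DX x)" for u
    using reindex_reindex[where \<psi> = ?to and \<phi> = ?from, OF to(1) from_to] that
    unfolding tangent_sum_def by blast
  have h_h': "?h (?h' u) = u" if "u \<in> carrier (tangent_sum DY y)" for u
    using reindex_reindex[where \<psi> = ?from and \<phi> = ?to, OF "from"(1) to_from] that
    unfolding tangent_sum_def by blast
  have bij: "bij_betw ?h (carrier (tangent_sum DX x)) (carrier (tangent_sum DY y))"
    by (rule bij_betw_byWitness[where f' = ?h']) (auto simp: h'_h h_h')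
  \<comment> \<open>The inclusion lemma with both spaces and both maps exchanged; \<open>gy\<close>
    identifies its base point \<open>g y\<close> with \<open>x\<close>.\<close>
  have h'_rel: "?h' ` tangent_relations DY y \<subseteq> tangent_relations DX x"
    by (rule reindex_tangent_relations[where f = g and g = chi,
          OF Y X g chi chi_g g_chi y, unfolded gy, OF _ _ h'])
  have "?h ` tangent_relations DX x \<subseteq> tangent_relations DY y"
    by (rule reindex_tangent_relations[where f = chi and g = g,
          OF X Y chi g g_chi chi_g assms(4), folded assms(5), OF _ _ h])
  \<comment> \<open>The preimage of a relation \<open>r\<close> is \<open>?h' r\<close>, a relation
    at \<open>x\<close> by \<open>h'_rel\<close>.\<close>
  moreover have "tangent_relations DY y \<subseteq> ?h ` tangent_relations DX x"
  proof
    fix r assume r: "r \<in> tangent_relations DY y"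
    then have "r \<in> carrier (tangent_sum DY y)" by (rule subsetD[OF tangent_relations_closed])
    then have "r = ?h (?h' r)" by (rule h_h'[symmetric])
    moreover have "?h' r \<in> tangent_relations DX x" using h'_rel r by blast
    ultimately show "r \<in> ?h ` tangent_relations DX x" by (rule image_eqI)
  qed
  ultimately have "?h ` tangent_relations DX x = tangent_relations DY y" by blast
  then have "?h ` LinearCombinations.module.span real_field (tangent_sum DX x) (tangent_relations DX x)
      = LinearCombinations.module.span real_field (tangent_sum DY y) (tangent_relations DY y)"
    using h.span_image[OF tangent_relations_closed] by simp
  then show ?thesis
    unfolding internal_tangent_space_def
    by (intro vectorspace_isomorphic_quotient_module[OF field_real_field h bij]
        h.M.span_is_submodule h.N.span_is_submodule tangent_relations_closed)
qed

end
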